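(* Let $G$ be a graph, let $(u,v,w)$ be a triangle in $G$, and suppose $w$ has degree two in $G$. Let $G'$ be the graph obtained from $G-w$ by attaching two new pendant vertices at $u$ and two new pendant vertices at $v$. Then $G$ admits a $3$-rs colouring if and only if $G'$ admits a $3$-rs colouring.
   Context: All graphs are finite, simple and undirected. A $3$-restricted star colouring ($3$-rs colouring) of a graph $G$ is a map $f:V(G)\to\{0,1,2\}$ with $f(x)\neq f(y)$ for every edge $xy$ and with no path $x,y,z$ in $G$ (not necessarily induced) such that $f(y)>f(x)=f(z)$. *)

theory Defs
  imports "Graph_Theory.Pair_Digraph"
begin

text \<open>
  A finite simple undirected graph is a \<open>pair_graph\<close>: finite, loop-free, and with a
  symmetric arc set, so that an edge \<open>xy\<close> is present as both arcs \<open>(x, y)\<close> and \<open>(y, x)\<close>.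
\<close>

text \<open>
  Only the values on vertices are constrained. In the last condition, \<open>x, y, z\<close> is a path;
  \<open>x \<noteq> y\<close> and \<open>y \<noteq> z\<close> hold because there are no loops.
\<close>

definition rs3_colouring :: "'a pair_pre_digraph \<Rightarrow> ('a \<Rightarrow> nat) \<Rightarrow> bool" where
  "rs3_colouring G f \<longleftrightarrow>
     (\<forall>x\<in>pverts G. f x \<in> {0, 1, 2}) \<and>
     (\<forall>x y. (x, y) \<in> parcs G \<longrightarrow> f x \<noteq> f y) \<and>
     \<not> (\<exists>x y z. (x, y) \<in> parcs G \<and> (y, z) \<in> parcs G \<and> x \<noteq> z \<and> f y > f x \<and> f x = f z)"

definition rs3_colourable :: "'a pair_pre_digraph \<Rightarrow> bool" where
  "rs3_colourable G \<longleftrightarrow> (\<exists>f. rs3_colouring G f)"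

definition triangle :: "'a pair_pre_digraph \<Rightarrow> 'a \<Rightarrow> 'a \<Rightarrow> 'a \<Rightarrow> bool" where
  "triangle G u v w \<longleftrightarrow> (u, v) \<in> parcs G \<and> (v, w) \<in> parcs G \<and> (u, w) \<in> parcs G"

definition delete_vertex :: "'a pair_pre_digraph \<Rightarrow> 'a \<Rightarrow> 'a pair_pre_digraph" where
  "delete_vertex G w =
     \<lparr> pverts = pverts G - {w}, parcs = {(x, y) \<in> parcs G. x \<noteq> w \<and> y \<noteq> w} \<rparr>"

lemma with_proj_delete_vertex:
  "with_proj (delete_vertex G w) = pre_digraph.del_vert (with_proj G) w"
  by (auto simp: delete_vertex_def with_proj_def pre_digraph.del_vert_def)

text \<open>
  Attach \<open>k x\<close> new pendant vertices at each vertex \<open>x\<close>. The old vertices are tagged \<open>Inl\<close>;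
  the \<open>i\<close>-th new vertex at \<open>x\<close> is \<open>Inr (x, i)\<close>, so freshness needs no assumption on the
  size of the vertex type.
\<close>

definition attach_pendants ::
  "'a pair_pre_digraph \<Rightarrow> ('a \<Rightarrow> nat) \<Rightarrow> ('a + 'a \<times> nat) pair_pre_digraph" where
  "attach_pendants G k =
     \<lparr> pverts = Inl ` pverts G \<union> {Inr (x, i) | x i. x \<in> pverts G \<and> i < k x},
       parcs = {(Inl x, Inl y) | x y. (x, y) \<in> parcs G}
         \<union> {(Inl x, Inr (x, i)) | x i. x \<in> pverts G \<and> i < k x}
         \<union> {(Inr (x, i), Inl x) | x i. x \<in> pverts G \<and> i < k x} \<rparr>"

lemma pair_graph_iff:
  "pair_graph G \<longleftrightarrow> finite (pverts G) \<and> parcs G \<subseteq> pverts G \<times> pverts G \<and>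
     sym (parcs G) \<and> irrefl (parcs G)"
proof
  assume "pair_graph G"
  then interpret pair_graph G .
  show "finite (pverts G) \<and> parcs G \<subseteq> pverts G \<times> pverts G \<and> sym (parcs G) \<and> irrefl (parcs G)"
    using pair_finite_verts arc_fst_in_verts arc_snd_in_verts pair_sym_arcs pair_no_loops
    by (fastforce simp: symmetric_def irrefl_def)
next
  assume *: "finite (pverts G) \<and> parcs G \<subseteq> pverts G \<times> pverts G \<and> sym (parcs G) \<and> irrefl (parcs G)"
  then have "finite (parcs G)"
    by (meson finite_SigmaI finite_subset)
  with * show "pair_graph G"
    by unfold_locales (auto simp: symmetric_def irrefl_def)
qed

lemma pair_graph_delete_vertex:
  "pair_graph G \<Longrightarrow> pair_graph (delete_vertex G w)"
  unfolding pair_graph_iff by (auto simp: delete_vertex_def sym_def irrefl_def)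

lemma pair_graph_attach_pendants:
  assumes "pair_graph G"
  shows "pair_graph (attach_pendants G k)"
proof -
  have "pverts (attach_pendants G k) = Inl ` pverts G \<union> Inr ` (SIGMA x:pverts G. {..<k x})"
    by (auto simp: attach_pendants_def)
  moreover have "finite (pverts G)"
    using assms by (simp add: pair_graph_iff)
  ultimately have "finite (pverts (attach_pendants G k))"
    by simp
  then show ?thesis
    using assms unfolding pair_graph_iff
    by (auto simp: attach_pendants_def sym_def irrefl_def)
qed

end

theory Submission
  imports Defs "HOL-Combinatorics.Transposition"
begin

text \<open>
  A vertex of colour 2 has at most one neighbour of each colour 0 and 1, hence degree at most two.
  In \<open>G'\<close> the vertices \<open>u\<close> and \<open>v\<close> have degree at least three, so they carry the colours 0 and 1,
  and \<open>w\<close> can be given colour 2. Conversely, colour 2 occurs on the triangle of \<open>G\<close>, at a vertex of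
  degree two; such a vertex is a twin of \<open>w\<close>, and exchanging the two we may assume that it is \<open>w\<close>.
  Then \<open>u\<close> and \<open>v\<close> have colours 0 and 1, and all pendant vertices can be given colour 2.
\<close>

lemma rs3_colouring_range: "rs3_colouring G f \<Longrightarrow> x \<in> pverts G \<Longrightarrow> f x \<in> {0, 1, 2}"
  unfolding rs3_colouring_def by blast

lemma rs3_colouring_proper: "rs3_colouring G f \<Longrightarrow> (x, y) \<in> parcs G \<Longrightarrow> f x \<noteq> f y"
  unfolding rs3_colouring_def by blast

lemma rs3_colouring_path:
  "rs3_colouring G f \<Longrightarrow> (x, y) \<in> parcs G \<Longrightarrow> (y, z) \<in> parcs G \<Longrightarrow> f x = f z \<Longrightarrow> f x < f y \<Longrightarrow> x = z"
  unfolding rs3_colouring_def by blast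

text \<open>Neighbours of \<open>y\<close> are coloured 0 or 1, and two distinct ones of equal
  colour would be the ends of a forbidden path through \<open>y\<close>; now apply the pigeonhole
  principle. Phrasing the degree bound as a coincidence among three named neighbours avoids
  cardinalities.\<close>

lemma rs3_colouring_top_degree:
  assumes "pair_graph G" "rs3_colouring G f" "f y = 2"
    and "(y, a) \<in> parcs G" "(y, b) \<in> parcs G" "(y, c) \<in> parcs G"
  shows "a = b \<or> a = c \<or> b = c"
proof (rule ccontr)
  assume distinct: "\<not> ?thesis"
  have sym: "(p, q) \<in> parcs G \<Longrightarrow> (q, p) \<in> parcs G" for p q
    using assms(1) by (auto simp: pair_graph_iff dest: symD)
  have low: "f x < 2" if "(y, x) \<in> parcs G" for x
  proof -
    have "x \<in> pverts G" using assms(1) that by (auto simp: pair_graph_iff)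
    then show ?thesis using rs3_colouring_range[OF assms(2), of x] rs3_colouring_proper[OF assms(2) that] assms(3)
      by auto
  qed
  have "f p \<noteq> f q" if "(y, p) \<in> parcs G" "(y, q) \<in> parcs G" "p \<noteq> q" for p q
    using rs3_colouring_path[OF assms(2) sym[OF that(1)] that(2)] low[OF that(1)] assms(3) that(3)
    by auto
  then have "f a \<noteq> f b" "f a \<noteq> f c" "f b \<noteq> f c" using assms(4-6) distinct by auto
  with low[OF assms(4)] low[OF assms(5)] low[OF assms(6)] show False by linarith
qed

text \<open>Colourings pull back along injective homomorphisms. Injectivity keeps the two ends of a
  path distinct, so that a forbidden path in \<open>G\<close> is mapped to one in \<open>H\<close>.
  This serves both for automorphisms and for restriction to a subgraph.\<close>

lemma rs3_colouring_compose:
  assumes "rs3_colouring H f" "inj \<pi>"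
    and "\<And>x. x \<in> pverts G \<Longrightarrow> \<pi> x \<in> pverts H"
    and "\<And>x y. (x, y) \<in> parcs G \<Longrightarrow> (\<pi> x, \<pi> y) \<in> parcs H"
  shows "rs3_colouring G (f \<circ> \<pi>)"
  unfolding rs3_colouring_def
proof (intro conjI allI ballI impI notI)
  show "(f \<circ> \<pi>) x \<in> {0, 1, 2}" if "x \<in> pverts G" for x
    using rs3_colouring_range[OF assms(1) assms(3)[OF that]] by simp
next
  fix x y assume "(x, y) \<in> parcs G" "(f \<circ> \<pi>) x = (f \<circ> \<pi>) y"
  then show False using rs3_colouring_proper[OF assms(1) assms(4)] by auto
next
  assume "\<exists>x y z. (x, y) \<in> parcs G \<and> (y, z) \<in> parcs G \<and> x \<noteq> z \<and>
    (f \<circ> \<pi>) y > (f \<circ> \<pi>) x \<and> (f \<circ> \<pi>) x = (f \<circ> \<pi>) z"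
  then obtain x y z where *: "(x, y) \<in> parcs G" "(y, z) \<in> parcs G" "x \<noteq> z"
    "f (\<pi> y) > f (\<pi> x)" "f (\<pi> x) = f (\<pi> z)" by auto
  have "\<pi> x = \<pi> z" using rs3_colouring_path[OF assms(1) assms(4)[OF *(1)] assms(4)[OF *(2)] *(5,4)] .
  then show False using *(3) assms(2) by (simp add: inj_eq)
qed

text \<open>The adjacent vertices \<open>v\<close> and \<open>w\<close> have the same closed
  neighbourhood, so their transposition is an automorphism of \<open>G\<close>.\<close>

lemma rs3_colouring_swap_twins:
  assumes "pair_graph G" "rs3_colouring G f"
    and v: "\<And>y. (v, y) \<in> parcs G \<longleftrightarrow> y = u \<or> y = w"
    and w: "\<And>y. (w, y) \<in> parcs G \<longleftrightarrow> y = u \<or> y = v"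
  shows "rs3_colouring G (f \<circ> transpose v w)"
proof (rule rs3_colouring_compose[OF assms(2)])
  have sym: "(p, q) \<in> parcs G \<longleftrightarrow> (q, p) \<in> parcs G" for p q
    using assms(1) by (auto simp: pair_graph_iff dest: symD)
  have irr: "(p, p) \<notin> parcs G" for p
    using assms(1) by (auto simp: pair_graph_iff irrefl_def)
  have "v \<in> pverts G" "w \<in> pverts G"
    using assms(1) v w by (auto simp: pair_graph_iff)
  then show "transpose v w x \<in> pverts G" if "x \<in> pverts G" for x
    using that by (auto simp: transpose_def)
  have "u \<noteq> v" "u \<noteq> w" "v \<noteq> w" using v w irr by metis+
  then show "(transpose v w x, transpose v w y) \<in> parcs G" if "(x, y) \<in> parcs G" for x y
    using that v w sym[of x v] sym[of x w] irr by (auto simp: transpose_def)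
qed simp

lemma out_degree_two_neighbours:
  assumes "pair_graph G" "out_degree (with_proj G) w = 2"
    and "(w, u) \<in> parcs G" "(w, v) \<in> parcs G" "u \<noteq> v"
  shows "(w, y) \<in> parcs G \<longleftrightarrow> y = u \<or> y = v"
proof -
  let ?A = "out_arcs (with_proj G) w"
  have "card ?A = 2" using assms(2) by (simp add: out_degree_def)
  moreover have "{(w, u), (w, v)} \<subseteq> ?A" "card {(w, u), (w, v)} = 2"
    using assms(3-5) by (auto simp: out_arcs_def)
  \<comment> \<open>An infinite set has \<open>card\<close> 0, so a cardinality of 2 already forces
    finiteness.\<close>
  moreover have "finite ?A" using \<open>card ?A = 2\<close> card.infinite by fastforce
  ultimately have "?A = {(w, u), (w, v)}" using card_subset_eq by metis
  moreover have "(w, y) \<in> parcs G \<longleftrightarrow> (w, y) \<in> ?A" by (auto simp: out_arcs_def)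
  ultimately show ?thesis by auto
qed

lemma rs3_colouring_top_at_apex:
  assumes "pair_graph G" "rs3_colouring G f"
    and "(u, v) \<in> parcs G"
    and w: "\<And>y. (w, y) \<in> parcs G \<longleftrightarrow> y = u \<or> y = v"
  shows "\<exists>g. rs3_colouring G g \<and> g w = 2"
proof -
  have sym: "(p, q) \<in> parcs G \<Longrightarrow> (q, p) \<in> parcs G" for p q
    using assms(1) by (auto simp: pair_graph_iff dest: symD)
  have irr: "(p, p) \<notin> parcs G" for p
    using assms(1) by (auto simp: pair_graph_iff irrefl_def)
  \<comment> \<open>Here \<open>b\<close> is the end of the edge \<open>uv\<close> that has colour
    2, and \<open>a\<close> is the other end; this covers both cases at once.\<close>
  have swap: "\<exists>g. rs3_colouring G g \<and> g w = 2"
    if "f b = 2" "(a, b) \<in> parcs G" "\<And>y. (w, y) \<in> parcs G \<longleftrightarrow> y = a \<or> y = b" for a b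
  proof -
    have "(b, a) \<in> parcs G" "(b, w) \<in> parcs G" "a \<noteq> w"
      using that sym irr by blast+
    \<comment> \<open>\<open>b\<close> already has the two distinct neighbours \<open>a\<close> and
      \<open>w\<close>, so colour 2 leaves no room for a third.\<close>
    then have "(b, y) \<in> parcs G \<longleftrightarrow> y = a \<or> y = w" for y
      using rs3_colouring_top_degree[OF assms(1,2) that(1), of a w y] by auto
    then have "rs3_colouring G (f \<circ> transpose b w)"
      by (rule rs3_colouring_swap_twins[OF assms(1,2) _ that(3)])
    then show ?thesis using that(1) by (intro exI[of _ "f \<circ> transpose b w"]) simp
  qed
  have arcs: "(w, u) \<in> parcs G" "(w, v) \<in> parcs G" using w by auto
  have "u \<in> pverts G" "v \<in> pverts G" "w \<in> pverts G"
    using assms(1,3) arcs by (auto simp: pair_graph_iff)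
  then have "f u \<in> {0, 1, 2}" "f v \<in> {0, 1, 2}" "f w \<in> {0, 1, 2}"
    using assms(2) by (auto simp: rs3_colouring_def)
  moreover have "f w \<noteq> f u" "f w \<noteq> f v" "f u \<noteq> f v"
    using assms(2,3) arcs by (auto simp: rs3_colouring_def)
  ultimately consider "f w = 2" | "f v = 2" | "f u = 2" by auto
  then show ?thesis
  proof cases
    case 1
    then show ?thesis using assms(2) by blast
  next
    case 2
    then show ?thesis using swap[of v u] assms(3) w by blast
  next
    case 3
    then show ?thesis using swap[of u v] sym[OF assms(3)] w by blast
  qed
qed

text \<open>A pendant vertex has a single neighbour and so is never the middle of a path; as an end
  with colour 2 it would need a middle vertex of colour above 2.\<close>

lemma rs3_colouring_attach_pendants:
  assumes "rs3_colouring G f" "\<And>x. x \<in> pverts G \<Longrightarrow> k x > 0 \<Longrightarrow> f x < 2"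
  shows "rs3_colouring (attach_pendants G k) (case_sum f (\<lambda>_. 2))"
  unfolding rs3_colouring_def
proof (intro conjI allI ballI impI notI)
  let ?H = "attach_pendants G k" and ?g = "case_sum f (\<lambda>_. 2)"
  fix x assume "x \<in> pverts ?H"
  then show "?g x \<in> {0, 1, 2}"
    using assms(1) by (auto simp: attach_pendants_def rs3_colouring_def)
next
  let ?H = "attach_pendants G k" and ?g = "case_sum f (\<lambda>_. 2)"
  fix x y assume "(x, y) \<in> parcs ?H" "?g x = ?g y"
  then show False
    using assms by (fastforce simp: attach_pendants_def rs3_colouring_def)
next
  let ?H = "attach_pendants G k" and ?g = "case_sum f (\<lambda>_. 2)"
  assume "\<exists>x y z. (x, y) \<in> parcs ?H \<and> (y, z) \<in> parcs ?H \<and> x \<noteq> z \<and> ?g y > ?g x \<and> ?g x = ?g z"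
  then obtain x y z where *: "(x, y) \<in> parcs ?H" "(y, z) \<in> parcs ?H" "x \<noteq> z"
    "?g y > ?g x" "?g x = ?g z" by blast
  show False
  proof (cases y)
    case (Inr p)
    then show ?thesis using * by (auto simp: attach_pendants_def)
  next
    case (Inl b)
    have "f b \<le> 2" if "b \<in> pverts G" using assms(1) that by (fastforce simp: rs3_colouring_def)
    then obtain a c where "x = Inl a" "z = Inl c"
      using * Inl assms(2)[of b] by (cases x; cases z) (auto simp: attach_pendants_def)
    then show ?thesis
      using * Inl rs3_colouring_path[OF assms(1), of a b c] by (auto simp: attach_pendants_def)
  qed
qed

lemma rs3_colouring_delete_vertex:
  "rs3_colouring G f \<Longrightarrow> rs3_colouring (delete_vertex G w) f"
  unfolding rs3_colouring_def delete_vertex_def by auto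

lemma rs3_colouring_attach_pendants_Inl:
  "rs3_colouring (attach_pendants G k) g \<Longrightarrow> rs3_colouring G (g \<circ> Inl)"
  by (erule rs3_colouring_compose) (auto simp: attach_pendants_def)

text \<open>With the largest colour, \<open>w\<close> cannot be an end of a forbidden path, and
  injectivity of \<open>f\<close> on its neighbourhood prevents it from being the middle.\<close>

lemma rs3_colouring_extend_top:
  assumes "pair_graph G" "rs3_colouring (delete_vertex G w) f"
    and "\<And>y. (w, y) \<in> parcs G \<Longrightarrow> f y < 2"
    and inj: "inj_on f {y. (w, y) \<in> parcs G}"
  shows "rs3_colouring G (f(w := 2))"
proof -
  have sym: "(p, q) \<in> parcs G \<Longrightarrow> (q, p) \<in> parcs G" for p q
    using assms(1) by (auto simp: pair_graph_iff dest: symD)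
  have irr: "(p, p) \<notin> parcs G" for p
    using assms(1) by (auto simp: pair_graph_iff irrefl_def)
  have verts: "f x \<in> {0, 1, 2}" if "x \<in> pverts G" "x \<noteq> w" for x
    using assms(2) that by (auto simp: rs3_colouring_def delete_vertex_def)
  have proper: "f x \<noteq> f y" if "(x, y) \<in> parcs G" "x \<noteq> w" "y \<noteq> w" for x y
    using assms(2) that by (auto simp: rs3_colouring_def delete_vertex_def)
  have path: False if "(x, y) \<in> parcs G" "(y, z) \<in> parcs G" "x \<noteq> z" "x \<noteq> w" "y \<noteq> w" "z \<noteq> w"
    "f x < f y" "f x = f z" for x y z
    using rs3_colouring_path[OF assms(2), of x y z] that by (auto simp: delete_vertex_def)
  have top: "(f(w := 2)) y \<le> 2" if "y \<in> pverts G" for y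
    using verts[OF that] by fastforce
  show ?thesis
    unfolding rs3_colouring_def
  proof (intro conjI allI ballI impI notI)
    show "(f(w := 2)) x \<in> {0, 1, 2}" if "x \<in> pverts G" for x
      using verts[OF that] by auto
  next
    fix x y assume "(x, y) \<in> parcs G" "(f(w := 2)) x = (f(w := 2)) y"
    then show False
      using proper[of x y] assms(3)[of x] assms(3)[of y] sym[of x y] irr[of w]
      by (auto split: if_splits)
  next
    assume "\<exists>x y z. (x, y) \<in> parcs G \<and> (y, z) \<in> parcs G \<and> x \<noteq> z \<and>
      (f(w := 2)) y > (f(w := 2)) x \<and> (f(w := 2)) x = (f(w := 2)) z"
    then obtain x y z where *: "(x, y) \<in> parcs G" "(y, z) \<in> parcs G" "x \<noteq> z"
      "(f(w := 2)) y > (f(w := 2)) x" "(f(w := 2)) x = (f(w := 2)) z" by blast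
    have "y \<in> pverts G" using assms(1) *(1) by (auto simp: pair_graph_iff)
    then have "x \<noteq> w" "z \<noteq> w" using *(4,5) top[of y] by (metis fun_upd_same not_le)+
    moreover from this have "y \<noteq> w"
      using * sym[OF *(1)] inj_onD[OF inj, of x z] by auto
    ultimately show False using * path[of x y z] by auto
  qed
qed

theorem theorem10:
  fixes G :: "'a pair_pre_digraph" and u v w :: 'a
  assumes "pair_graph G"
    and "triangle G u v w"
    and "out_degree (with_proj G) w = 2"
  shows "rs3_colourable G \<longleftrightarrow>
    rs3_colourable (attach_pendants (delete_vertex G w) ((\<lambda>_. 0)(u := 2, v := 2)))"
proof -
  let ?k = "(\<lambda>_. 0)(u := 2, v := 2) :: 'a \<Rightarrow> nat"
  let ?D = "delete_vertex G w"
  let ?H = "attach_pendants ?D ?k"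
  have sym: "(p, q) \<in> parcs G \<Longrightarrow> (q, p) \<in> parcs G" for p q
    using assms(1) by (auto simp: pair_graph_iff dest: symD)
  have irr: "(p, p) \<notin> parcs G" for p
    using assms(1) by (auto simp: pair_graph_iff irrefl_def)
  have uv: "(u, v) \<in> parcs G" "(v, u) \<in> parcs G" and wu: "(w, u) \<in> parcs G" and wv: "(w, v) \<in> parcs G"
    using assms(2) sym by (auto simp: triangle_def)
  then have ne: "u \<noteq> v" "u \<noteq> w" "v \<noteq> w" using irr by auto
  have w: "(w, y) \<in> parcs G \<longleftrightarrow> y = u \<or> y = v" for y
    using out_degree_two_neighbours[OF assms(1,3) wu wv ne(1)] .
  have verts: "u \<in> pverts G" "v \<in> pverts G" "w \<in> pverts G"
    using assms(1) uv wu by (auto simp: pair_graph_iff)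
  show ?thesis
  proof
    assume "rs3_colourable G"
    then obtain f where f: "rs3_colouring G f" "f w = 2"
      using rs3_colouring_top_at_apex[OF assms(1) _ uv(1) w] unfolding rs3_colourable_def by blast
    have "f u < 2" "f v < 2"
      using f verts wu wv by (fastforce simp: rs3_colouring_def)+
    then have "rs3_colouring ?H (case_sum f (\<lambda>_. 2))"
      by (intro rs3_colouring_attach_pendants rs3_colouring_delete_vertex f(1))
        (auto split: if_splits)
    then show "rs3_colourable ?H" unfolding rs3_colourable_def by blast
  next
    assume "rs3_colourable ?H"
    then obtain g where g: "rs3_colouring ?H g" unfolding rs3_colourable_def by blast
    have H: "pair_graph ?H"
      by (intro pair_graph_attach_pendants pair_graph_delete_vertex assms(1))
    \<comment> \<open>In \<open>?H\<close>, the vertex \<open>Inl x\<close> is adjacent to the other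
      end of the edge \<open>uv\<close> and to its own two pendants. These three neighbours exclude
      colour 2, which is why two pendants are attached at each end.\<close>
    have low: "g (Inl x) < 2" if "x \<in> {u, v}" "y \<in> {u, v}" "(x, y) \<in> parcs G" for x y
    proof -
      have arcs: "(Inl x, Inl y) \<in> parcs ?H" "(Inl x, Inr (x, 0)) \<in> parcs ?H"
        "(Inl x, Inr (x, 1)) \<in> parcs ?H"
        using that verts ne by (auto simp: attach_pendants_def delete_vertex_def)
      have "Inl x \<in> pverts ?H"
        using that verts ne by (auto simp: attach_pendants_def delete_vertex_def)
      then have "g (Inl x) \<in> {0, 1, 2}" using g by (auto simp: rs3_colouring_def)
      moreover have "g (Inl x) \<noteq> 2"
        using rs3_colouring_top_degree[OF H g _ arcs] by auto
      ultimately show ?thesis by auto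
    qed
    have D: "rs3_colouring ?D (g \<circ> Inl)"
      using g by (rule rs3_colouring_attach_pendants_Inl)
    have "(u, v) \<in> parcs ?D" using uv ne by (simp add: delete_vertex_def)
    then have "g (Inl u) \<noteq> g (Inl v)" using D by (auto simp: rs3_colouring_def)
    \<comment> \<open>The neighbours of \<open>w\<close> are exactly \<open>u\<close> and
      \<open>v\<close>, whose colours are distinct and below 2, as the extension requires.\<close>
    then have "rs3_colouring G ((g \<circ> Inl)(w := 2))"
      using low uv by (intro rs3_colouring_extend_top[OF assms(1) D]) (auto simp: w inj_on_def)
    then show "rs3_colourable G" unfolding rs3_colourable_def by blast
  qed
qed

end
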